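(* Let $\{u_i\}_{i\in I}$ be a system of finitely many vectors in $\mathbb{R}^n$, with $I$ nonempty, and let $$f:\mathbb{R}^n\to\mathbb{R}:\ x\mapsto\max_{i\in I}\{|\langle u_i,x\rangle|\}.$$ Then $f^*=\iota_D$, where $$D:=\operatorname{conv}\bigcup_{i\in I}\{u_i,-u_i\}.$$ Consequently, $\operatorname{Prox}_f=\operatorname{Id}-P_D$.
   Context: $\mathbb{R}^n$ carries the standard inner product $\langle\cdot,\cdot\rangle$ and the induced norm $\|\cdot\|$. $\operatorname{conv}$ denotes the convex hull and $\operatorname{Id}$ the identity map. The Fenchel conjugate of $f$ is $f^*(x^* ):=\sup_{x\in\mathbb{R}^n}(\langle x^*,x\rangle-f(x))\in(-\infty,+\infty]$. The indicator function $\iota_D$ of a set $D$ is $\iota_D(x)=0$ if $x\in D$ and $\iota_D(x)=+\infty$ otherwise. For a proper convex lower semicontinuous function $f$, $\operatorname{Prox}_f(x)$ is the unique minimizer of $y\mapsto f(y)+\tfrac12\|x-y\|^2$. For a nonempty closed convex set $D$, $P_D x$ is the unique point of $D$ closest to $x$. *)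

theory Defs
  imports "HOL-Analysis.Analysis"
begin

definition fenchel_conjugate :: "('a::euclidean_space \<Rightarrow> ereal) \<Rightarrow> 'a \<Rightarrow> ereal" where
  "fenchel_conjugate f xs = (SUP x. ereal (xs \<bullet> x) - f x)"

definition indicator_fun :: "'a set \<Rightarrow> 'a \<Rightarrow> ereal" where
  "indicator_fun D x = (if x \<in> D then 0 else \<infinity>)"

(* The minimizer exists and is unique when f is proper, convex and lower semicontinuous;
   for other f the value of the definite description may be unspecified. *)
definition Prox :: "('a::euclidean_space \<Rightarrow> ereal) \<Rightarrow> 'a \<Rightarrow> 'a" where
  "Prox f x = (THE p. is_arg_min (\<lambda>y. f y + ereal ((norm (x - y))\<^sup>2 / 2)) (\<lambda>y. True) p)"

end

theory Submission
  imports Defs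
begin

text \<open>
  The function \<open>f\<close> is the support function of the polytope \<open>D\<close>: the maximum of a linear
  functional over a convex hull is its maximum over the generators, and
  \<open>max (u \<bullet> x) (- u \<bullet> x) = \<bar>u \<bullet> x\<bar>\<close>. Both claims hold for the support function \<open>s\<close> of any
  nonempty closed convex set \<open>D\<close> on which every linear functional attains its maximum.

  If \<open>z \<in> D\<close>, then \<open>z \<bullet> x - s x \<le> 0\<close> with equality at \<open>x = 0\<close>. If \<open>z \<notin> D\<close>, a hyperplane that
  strictly separates \<open>z\<close> from \<open>D\<close> yields \<open>v\<close> with \<open>z \<bullet> v > s v\<close>, and by positive homogeneity the
  supremum along the ray through \<open>v\<close> is infinite. Hence the conjugate of \<open>s\<close> is the indicator
  of \<open>D\<close>.

  For the proximal map, let \<open>q\<close> be the projection of \<open>x\<close> onto \<open>D\<close> and \<open>p = x - q\<close>. The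
  variational inequality \<open>p \<bullet> (d - q) \<le> 0\<close> for \<open>d \<in> D\<close> says that \<open>s p = q \<bullet> p\<close>. Together
  with \<open>s y \<ge> q \<bullet> y\<close>, expanding the square shows that the value of \<open>s y + (norm (x - y))\<^sup>2 / 2\<close>
  exceeds its value at \<open>p\<close> by at least \<open>(norm (y - p))\<^sup>2 / 2\<close>, so \<open>p\<close> is its unique minimizer.
\<close>

text \<open>The function \<open>s\<close> is the support function of \<open>D\<close>, and the supremum defining it is attained at
  every \<open>x\<close>. Attainment forces \<open>D\<close> to be nonempty.\<close>
definition attained_support :: "('a::euclidean_space \<Rightarrow> real) \<Rightarrow> 'a set \<Rightarrow> bool" where
  "attained_support s D \<longleftrightarrow> (\<forall>x. (\<forall>d\<in>D. d \<bullet> x \<le> s x) \<and> (\<exists>d\<in>D. d \<bullet> x = s x))"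

lemma attained_support_upper:
  "attained_support s D \<Longrightarrow> d \<in> D \<Longrightarrow> d \<bullet> x \<le> s x"
  by (auto simp: attained_support_def)

lemma attained_support_attained:
  assumes "attained_support s D"
  obtains d where "d \<in> D" "d \<bullet> x = s x"
  using assms by (auto simp: attained_support_def)

lemma attained_support_scaleR_le:
  assumes "attained_support s D" "0 \<le> t"
  shows "s (t *\<^sub>R x) \<le> t * s x"
proof -
  obtain d where d: "d \<in> D" "d \<bullet> (t *\<^sub>R x) = s (t *\<^sub>R x)"
    using attained_support_attained[OF assms(1)] .
  have "t * (d \<bullet> x) \<le> t * s x"
    using attained_support_upper[OF assms(1) d(1)] assms(2) by (rule mult_left_mono)
  then show ?thesis using d(2) by simp
qed

lemma fenchel_conjugate_support:
  fixes s :: "'a::euclidean_space \<Rightarrow> real"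
  assumes "closed D" "convex D" and s: "attained_support s D"
  shows "fenchel_conjugate (\<lambda>x. ereal (s x)) = indicator_fun D"
proof
  fix z
  show "fenchel_conjugate (\<lambda>x. ereal (s x)) z = indicator_fun D z"
  proof (cases "z \<in> D")
    case True
    obtain d where "d \<in> D" "d \<bullet> 0 = s 0"
      using attained_support_attained[OF s] .
    then have s0: "s 0 = 0" by simp
    have "(SUP x. ereal (z \<bullet> x) - ereal (s x)) = 0"
    proof (rule antisym)
      show "(SUP x. ereal (z \<bullet> x) - ereal (s x)) \<le> 0"
        using attained_support_upper[OF s True] by (intro SUP_least) simp
      show "0 \<le> (SUP x. ereal (z \<bullet> x) - ereal (s x))"
        by (rule SUP_upper2[of 0]) (simp_all add: s0)
    qed
    then show ?thesis using True by (simp add: fenchel_conjugate_def indicator_fun_def)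
  next
    case False
    obtain a b where ab: "a \<bullet> z < b" "\<And>d. d \<in> D \<Longrightarrow> b < a \<bullet> d"
      using separating_hyperplane_closed_point[OF assms(2,1) False] by blast
    define v where "v = - a"
    obtain d where d: "d \<in> D" "d \<bullet> v = s v"
      using attained_support_attained[OF s] .
    have gap: "z \<bullet> v - s v > 0"
      using ab(1) ab(2)[OF d(1)] d(2) by (simp add: v_def inner_commute)
    have "(SUP x. ereal (z \<bullet> x) - ereal (s x)) = \<infinity>"
    proof (rule ereal_top)
      fix B :: real
      define t where "t = max 0 (B / (z \<bullet> v - s v))"
      have "B = B / (z \<bullet> v - s v) * (z \<bullet> v - s v)" using gap by simp
      also have "\<dots> \<le> t * (z \<bullet> v - s v)"
        using gap by (intro mult_right_mono) (simp_all add: t_def)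
      also have "\<dots> \<le> z \<bullet> (t *\<^sub>R v) - s (t *\<^sub>R v)"
        using attained_support_scaleR_le[OF s, of t v] by (simp add: t_def right_diff_distrib)
      finally show "ereal B \<le> (SUP x. ereal (z \<bullet> x) - ereal (s x))"
        by (intro SUP_upper2[of "t *\<^sub>R v"]) simp_all
    qed
    then show ?thesis using False by (simp add: fenchel_conjugate_def indicator_fun_def)
  qed
qed

text \<open>The objective of the proximal problem grows quadratically away from its minimizer.\<close>
lemma prox_objective_growth:
  fixes s :: "'a::euclidean_space \<Rightarrow> real"
  assumes "closed D" "convex D" and s: "attained_support s D"
    and p: "p = x - closest_point D x"
  shows "s p + (norm (x - p))\<^sup>2 / 2 + (norm (y - p))\<^sup>2 / 2 \<le> s y + (norm (x - y))\<^sup>2 / 2"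
proof -
  define q where "q = closest_point D x"
  have x: "x = q + p" using p by (simp add: q_def)
  obtain d where d: "d \<in> D" "d \<bullet> p = s p"
    using attained_support_attained[OF s] .
  then have q: "q \<in> D" using closest_point_in_set[OF assms(1)] by (auto simp: q_def)
  have "p \<bullet> (d - q) \<le> 0"
    using closest_point_dot[OF assms(2,1) d(1), of x] by (simp add: p q_def)
  then have "s p \<le> q \<bullet> p" using d(2) by (simp add: inner_diff_right inner_commute)
  moreover have "q \<bullet> y \<le> s y" using attained_support_upper[OF s q] .
  moreover have "(norm (x - y))\<^sup>2 = (norm (x - p))\<^sup>2 - 2 * (q \<bullet> y - q \<bullet> p) + (norm (y - p))\<^sup>2"
    unfolding x power2_norm_eq_inner by (simp add: algebra_simps inner_commute)
  ultimately show ?thesis by argo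
qed

lemma Prox_support:
  fixes s :: "'a::euclidean_space \<Rightarrow> real"
  assumes "closed D" "convex D" "attained_support s D"
  shows "Prox (\<lambda>x. ereal (s x)) = (\<lambda>x. x - closest_point D x)"
proof
  fix x
  define p where "p = x - closest_point D x"
  note growth = prox_objective_growth[OF assms p_def]
  show "Prox (\<lambda>x. ereal (s x)) x = x - closest_point D x"
    unfolding Prox_def p_def[symmetric]
  proof (rule the_equality)
    have "s p + (norm (x - p))\<^sup>2 / 2 \<le> s y + (norm (x - y))\<^sup>2 / 2" for y
      using growth[of y] zero_le_power2[of "norm (y - p)"] by linarith
    then show "is_arg_min (\<lambda>y. ereal (s y) + ereal ((norm (x - y))\<^sup>2 / 2)) (\<lambda>y. True) p"
      by (simp add: is_arg_min_def not_less)
  next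
    fix y
    assume "is_arg_min (\<lambda>y. ereal (s y) + ereal ((norm (x - y))\<^sup>2 / 2)) (\<lambda>y. True) y"
    then have "s y + (norm (x - y))\<^sup>2 / 2 \<le> s p + (norm (x - p))\<^sup>2 / 2"
      by (simp add: is_arg_min_def not_less)
    then have "(norm (y - p))\<^sup>2 \<le> 0" using growth[of y] by linarith
    then show "y = p" by simp
  qed
qed

lemma attained_support_symmetric_hull:
  fixes u :: "'i \<Rightarrow> 'a::euclidean_space"
  assumes "finite I" "I \<noteq> {}"
  shows "attained_support (\<lambda>x. MAX i\<in>I. \<bar>u i \<bullet> x\<bar>) (convex hull (\<Union>i\<in>I. {u i, - u i}))"
  unfolding attained_support_def
proof (intro allI conjI ballI)
  fix x
  let ?G = "\<Union>i\<in>I. {u i, - u i}" and ?m = "MAX i\<in>I. \<bar>u i \<bullet> x\<bar>"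
  have "\<bar>u i \<bullet> x\<bar> \<le> ?m" if "i \<in> I" for i
    using assms that by (intro Max_ge) auto
  then have "?G \<subseteq> {d. x \<bullet> d \<le> ?m}" by (fastforce simp: inner_commute abs_le_iff)
  then have "convex hull ?G \<subseteq> {d. x \<bullet> d \<le> ?m}"
    by (intro hull_minimal convex_halfspace_le)
  then show "d \<bullet> x \<le> ?m" if "d \<in> convex hull ?G" for d
    using that by (auto simp: inner_commute)
  have "?m \<in> (\<lambda>i. \<bar>u i \<bullet> x\<bar>) ` I" using assms by (intro Max_in) auto
  then obtain i where i: "i \<in> I" "?m = \<bar>u i \<bullet> x\<bar>" by auto
  have "u i \<in> ?G" "- u i \<in> ?G" using i(1) by auto
  then have "u i \<in> convex hull ?G" "- u i \<in> convex hull ?G" by (simp_all only: hull_inc)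
  moreover have "u i \<bullet> x = ?m \<or> (- u i) \<bullet> x = ?m" unfolding i(2) by auto
  ultimately show "\<exists>d\<in>convex hull ?G. d \<bullet> x = ?m" by blast
qed

theorem theorem7p2:
  fixes u :: "'i \<Rightarrow> real ^ 'n"
    and I :: "'i set"
    and f :: "real ^ 'n \<Rightarrow> real"
    and D :: "(real ^ 'n) set"
  assumes "finite I" and "I \<noteq> {}"
    and f_def: "f = (\<lambda>x. MAX i\<in>I. \<bar>u i \<bullet> x\<bar>)"
    and D_def: "D = convex hull (\<Union>i\<in>I. {u i, - u i})"
  shows "fenchel_conjugate (\<lambda>x. ereal (f x)) = indicator_fun D \<and>
         Prox (\<lambda>x. ereal (f x)) = (\<lambda>x. x - closest_point D x)"
proof -
  have "finite (\<Union>i\<in>I. {u i, - u i})" using assms(1) by simp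
  then have "closed D"
    unfolding D_def by (intro compact_imp_closed finite_imp_compact_convex_hull)
  moreover have "convex D" unfolding D_def by (rule convex_convex_hull)
  moreover have "attained_support f D"
    unfolding f_def D_def using assms(1,2) by (rule attained_support_symmetric_hull)
  ultimately show ?thesis by (simp add: fenchel_conjugate_support Prox_support)
qed

end
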